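(* Let $\{P_n\}_{n\ge 0}$ be an HG-family given by a pair $(R,f)$. Define rational functions $f_1(u):=f(u+1,u)^{-1}$, $f_2(u):=f(u+2,u)^{-1}f_1(u+1)$, and $$\alpha(u)=f_1(u-1)-f_1(u)-R(u),\qquad \beta(u)=f_2(u-1)-f_2(u)-f_1(u)\bigl(\alpha(u+1)+R(u)\bigr).$$ Suppose that $f_1$ and $f_2$ have no poles in non-negative integers, and that $(R,f)$ is as in one of the cases (a), (b), (c) of the list below: (a) $\deg R\le 2$ and there are polynomials $q,v\in\mathbb{C}[t]$ of degree $\le1$ with $f(u,s)=\dfrac{(s-u)q(s+u)}{s\,q(s)[R(s+1)-R(0)]+(s+1)v(s)}$; (b) $R$ is constant and for some $c,\lambda\in\mathbb{C}$, $f(u,s)=\lambda(s-u)(s-u+1-c)\dfrac{(s+u+1)(s+u+c)}{(s+1/2)(s+1)}$; (c) $R$ is constant and for some $c,\lambda\in\mathbb{C}$, $f(u,s)=\lambda(s-u)(s-u+1-c)\dfrac{(s+u+2)(s+u+c+1)}{(s+1)(s+3/2)}$. Then the family satisfies $$zP_n=P_{n+1}+\alpha_nP_n+\beta_{n-1}P_{n-1}\qquad\text{for all } n\in\mathbb{Z}_{\ge0}$$ (with $P_{-1}=0$), where $\alpha_n=\alpha(n)$ and $\beta_n=\beta(n)$ for all $n>0$, and $\alpha_0=\alpha(0)-f_1(-1)$, $\beta_0=\beta(0)-f_2(-1)$.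
   Context: A family of polynomials is a sequence $\mathcal{P}=(P_0,P_1,\dots)$ where $P_n\in\mathbb{C}[z]$ is monic of degree $n$. For $R\in\mathbb{C}[s]$ the Newtonian basis given by $R$ is the sequence $\{\Phi_k\}$ with $\Phi_{-1}=0$, $\Phi_0=1$, $\Phi_{k+1}=z\Phi_k+R(k)\Phi_k$ for $k\ge 0$. Write $P_n=\sum_{k=0}^n c(n,k)\Phi_k$; thus $c(n,n)=1$ for $n\ge 0$, and set $c(n,k)=0$ unless $n\ge k\ge 0$. $\mathcal{P}$ is an HG-family given by the pair $(R,f)$ if there are relatively prime polynomials $N\in\mathbb{C}[u,s]$ and $D\in\mathbb{C}[s]$ with $f=N/D$ such that, with respect to the Newtonian basis given by $R$, $D(k)c(n,k+1)=N(n,k)c(n,k)$ for all $n,k\in\mathbb{Z}$. Convention for $\alpha_0,\beta_0$: the functions $f_1,f_2$ may have a pole at $-1$; the formulas for $\alpha_0,\beta_0$ are understood after cancelling $f_1(-1)$, respectively $f_2(-1)$, i.e. $\alpha_0=-f_1(0)-R(0)$ and $\beta_0=-f_2(0)-f_1(0)(\alpha(1)+R(0))$. The values $\alpha(n),\beta(n)$ for $n>0$ are values of rational functions.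
   Formalization: Added hypothesis: the pair (R,f) determines the HG-family uniquely. Without it the claim fails, e.g. R=0, f=(s-u)(s+u-1)/(s(s+1)), where P_1=z+c is allowed for every c but the recurrence forces c=-1/2. *)

theory Defs
  imports
    "HOL-Computational_Algebra.Computational_Algebra"
    "HOL-Computational_Algebra.Field_as_Ring"
begin

(* C[u,s] is represented as (C[s])[u], the type complex poly poly: the outer variable is u and
   the inner one is s.  So for N in C[u,s] and p in C[s], poly N p is N(p(s), s).
   C(u,s) is complex poly poly fract; C(u) is complex poly fract. *)

definition bivar_u :: "complex poly poly" where
  "bivar_u = [:0, 1:]"

definition bivar_s :: "complex poly poly" where
  "bivar_s = [:[:0, 1:]:]"

definition bivar_const :: "complex \<Rightarrow> complex poly poly" where
  "bivar_const a = [:[:a:]:]"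

definition eval_bivar :: "complex poly poly \<Rightarrow> complex \<Rightarrow> complex \<Rightarrow> complex" where
  "eval_bivar N x y = poly (poly N [:x:]) y"

(* q(g(u,s)) for q in C[t] and g in C[u,s] *)
definition compose_bivar :: "complex poly \<Rightarrow> complex poly poly \<Rightarrow> complex poly poly" where
  "compose_bivar q g = poly (map_poly bivar_const q) g"

(* The numerator and denominator delivered by quot_of_fract are relatively prime, so poles and
   values are those of the rational function after cancellation. *)
definition ratfun_pole :: "complex poly fract \<Rightarrow> complex \<Rightarrow> bool" where
  "ratfun_pole F x \<longleftrightarrow> poly (snd (quot_of_fract F)) x = 0"

definition ratfun_eval :: "complex poly fract \<Rightarrow> complex \<Rightarrow> complex" where
  "ratfun_eval F x = poly (fst (quot_of_fract F)) x / poly (snd (quot_of_fract F)) x"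

(* F(u + a) *)
definition ratfun_shift :: "complex \<Rightarrow> complex poly fract \<Rightarrow> complex poly fract" where
  "ratfun_shift a F =
     Fract (pcompose (fst (quot_of_fract F)) [:a, 1:]) (pcompose (snd (quot_of_fract F)) [:a, 1:])"

(* f(u + a, u) *)
definition diag_shift :: "complex \<Rightarrow> complex poly poly fract \<Rightarrow> complex poly fract" where
  "diag_shift a f = Fract (poly (fst (quot_of_fract f)) [:a, 1:]) (poly (snd (quot_of_fract f)) [:a, 1:])"

fun newton_basis :: "complex poly \<Rightarrow> nat \<Rightarrow> complex poly" where
  "newton_basis R 0 = 1"
| "newton_basis R (Suc k) =
     [:0, 1:] * newton_basis R k + smult (poly R (of_nat k)) (newton_basis R k)"

definition poly_family :: "(nat \<Rightarrow> complex poly) \<Rightarrow> bool" where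
  "poly_family P \<longleftrightarrow> (\<forall>n. degree (P n) = n \<and> lead_coeff (P n) = 1)"

(* c n k are the coefficients of P in the Newtonian basis given by R, extended by 0 to all
   integers n, k; since the basis element with index k has degree k, they are unique. *)
definition newton_coeffs :: "complex poly \<Rightarrow> (nat \<Rightarrow> complex poly) \<Rightarrow> (int \<Rightarrow> int \<Rightarrow> complex) \<Rightarrow> bool" where
  "newton_coeffs R P c \<longleftrightarrow>
     (\<forall>n. P n = (\<Sum>k\<le>n. smult (c (int n) (int k)) (newton_basis R k))) \<and>
     (\<forall>n k. \<not> (n \<ge> k \<and> k \<ge> 0) \<longrightarrow> c n k = 0)"

(* Where D(k) = N(n,k) = 0 with n > k >= 0, the relation leaves c(n,k) free, so a pair (R, f) need
   not determine the family.  For R = 0 and f = (s - u)(s + u - 1)/(s(s + 1)), D(0) = N(1,0) = 0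
   and P_1 = z + c is possible for every c, although f1 = -(u + 1)/2 has no pole at 0. *)
definition HG_family :: "(nat \<Rightarrow> complex poly) \<Rightarrow> complex poly \<Rightarrow> complex poly poly fract \<Rightarrow> bool" where
  "HG_family P R f \<longleftrightarrow>
     poly_family P \<and>
     (\<exists>(N :: complex poly poly) (D :: complex poly) c.
        D \<noteq> 0 \<and> coprime N [:D:] \<and> f = Fract N [:D:] \<and>
        newton_coeffs R P c \<and>
        (\<forall>n k :: int. poly D (of_int k) * c n (k + 1) = eval_bivar N (of_int n) (of_int k) * c n k))"

definition f1 :: "complex poly poly fract \<Rightarrow> complex poly fract" where
  "f1 f = inverse (diag_shift 1 f)"

definition f2 :: "complex poly poly fract \<Rightarrow> complex poly fract" where
  "f2 f = inverse (diag_shift 2 f) * ratfun_shift 1 (f1 f)"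

definition alpha :: "complex poly \<Rightarrow> complex poly poly fract \<Rightarrow> complex poly fract" where
  "alpha R f = ratfun_shift (-1) (f1 f) - f1 f - to_fract R"

definition beta :: "complex poly \<Rightarrow> complex poly poly fract \<Rightarrow> complex poly fract" where
  "beta R f = ratfun_shift (-1) (f2 f) - f2 f - f1 f * (ratfun_shift 1 (alpha R f) + to_fract R)"

(* For n = 0 these are alpha(0) - f1(-1) and beta(0) - f2(-1) with the possibly infinite terms
   f1(-1) and f2(-1) cancelled. *)
definition alpha_coeff :: "complex poly \<Rightarrow> complex poly poly fract \<Rightarrow> nat \<Rightarrow> complex" where
  "alpha_coeff R f n =
     (if n = 0 then - ratfun_eval (f1 f) 0 - poly R 0
      else ratfun_eval (alpha R f) (of_nat n))"

definition beta_coeff :: "complex poly \<Rightarrow> complex poly poly fract \<Rightarrow> nat \<Rightarrow> complex" where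
  "beta_coeff R f n =
     (if n = 0
      then - ratfun_eval (f2 f) 0
           - ratfun_eval (f1 f) 0 * (ratfun_eval (alpha R f) 1 + poly R 0)
      else ratfun_eval (beta R f) (of_nat n))"

definition case_a :: "complex poly \<Rightarrow> complex poly poly fract \<Rightarrow> bool" where
  "case_a R f \<longleftrightarrow>
     degree R \<le> 2 \<and>
     (\<exists>q v :: complex poly. degree q \<le> 1 \<and> degree v \<le> 1 \<and>
        (let den = [:0, 1:] * q * (pcompose R [:1, 1:] - [:poly R 0:]) + [:1, 1:] * v
         in den \<noteq> 0 \<and>
            f = Fract ((bivar_s - bivar_u) * compose_bivar q (bivar_s + bivar_u)) [:den:]))"

definition case_b :: "complex poly \<Rightarrow> complex poly poly fract \<Rightarrow> bool" where
  "case_b R f \<longleftrightarrow>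
     degree R = 0 \<and>
     (\<exists>c l :: complex.
        f = Fract (bivar_const l * (bivar_s - bivar_u) * (bivar_s - bivar_u + bivar_const (1 - c))
                   * (bivar_s + bivar_u + 1) * (bivar_s + bivar_u + bivar_const c))
                  ((bivar_s + bivar_const (1/2)) * (bivar_s + 1)))"

definition case_c :: "complex poly \<Rightarrow> complex poly poly fract \<Rightarrow> bool" where
  "case_c R f \<longleftrightarrow>
     degree R = 0 \<and>
     (\<exists>c l :: complex.
        f = Fract (bivar_const l * (bivar_s - bivar_u) * (bivar_s - bivar_u + bivar_const (1 - c))
                   * (bivar_s + bivar_u + 2) * (bivar_s + bivar_u + bivar_const (c + 1)))
                  ((bivar_s + 1) * (bivar_s + bivar_const (3/2))))"

end

theory Submission
  imports Defs
begin

text \<open>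
  Expanding \<open>z P\<^sub>n\<close> in the Newtonian basis turns the recurrence into the scalar identities
  \<open>c(n, k - 1) - R(k) c(n, k) = c(n + 1, k) + \<alpha>\<^sub>n c(n, k) + \<beta>\<^sub>n\<^sub>-\<^sub>1 c(n - 1, k)\<close>, one for each \<open>k\<close>.
  The identity for \<open>k = n + 1\<close> is trivial, and those for \<open>k = n\<close> and \<open>k = n - 1\<close> can be solved for
  \<open>\<alpha>\<^sub>n\<close> and \<open>\<beta>\<^sub>n\<^sub>-\<^sub>1\<close>. Since \<open>c(n + 1, n) = f\<^sub>1(n)\<close> and \<open>c(n + 2, n) = f\<^sub>2(n)\<close>, the
  solutions are the values of the rational functions \<open>\<alpha>\<close> and \<open>\<beta>\<close> (\<open>alpha_coeff_eq\<close>,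
  \<open>beta_coeff_eq\<close>). What has to be proved is that the same two numbers serve all \<open>k \<le> n - 2\<close>.

  In each of the three cases \<open>N(n, k)\<close> is a product of functions of \<open>k - n\<close> and of \<open>k + n\<close>, so that
  the ratio \<open>N(n - 1, k) / N(n, k)\<close> telescopes in \<open>k\<close> and \<open>c(n, k) / c(n - 1, k)\<close> is an explicit
  rational function of \<open>k\<close> (\<open>row_ratio\<close>). After division by \<open>c(n - 1, k)\<close> and multiplication by the
  denominators the identity to be proved says that a certain polynomial \<open>B\<close> in \<open>k\<close> is a constant
  multiple of a known product. In case (a) the product is \<open>(n - k)(n + 1 - k)\<close>. The polynomial \<open>B\<close>
  vanishes at \<open>n\<close> and \<open>n + 1\<close>; its formal degree is four, but the denominator of \<open>f\<close> is
  chosen such that the coefficients of degree four and three cancel (\<open>three_term_quadratic\<close>). Cases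
  (b) and (c) are the values \<open>e = 0\<close> and \<open>e = 1\<close> of a common family, for which the product is
  \<open>(n - k)(n - 1 + c - k)(n + 1 - k)(n + c - k)\<close> and the claim is an identity between explicit
  polynomials of degree four (\<open>three_term_quartic\<close>).

  All this divides by \<open>N(n, k)\<close> for \<open>n > k \<ge> 0\<close> and by \<open>N(n, -1)\<close> for \<open>n \<ge> 2\<close>. The
  latter are products of nonzero numbers and of factors of the former. The former are nonzero because \<open>f\<close> determines
  the family: the denominator \<open>D\<close> vanishes at \<open>-1\<close>, hence a zero of \<open>N(n, \<cdot>)\<close> at a point of
  \<open>{0..<n}\<close> would make it possible to change the coefficients of \<open>P\<^sub>n\<close> at and below that
  point without violating any of the relations (\<open>numerator_nonzero_if_determined\<close>).
\<close>

section \<open>Values of rational functions\<close>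

lemma fract_eq_coprimeE:
  fixes p q A B :: "'a :: {factorial_ring_gcd,semiring_gcd_mult_normalize}"
  assumes "Fract p q = Fract A B" "q \<noteq> 0" "B \<noteq> 0" "coprime A B"
  obtains h where "p = A * h" "q = B * h"
proof -
  have e: "p * B = A * q" using assms by (simp add: eq_fract)
  hence "B dvd A * q" by (metis dvd_triv_right)
  hence "B dvd q" using assms(4) by (metis coprime_commute coprime_dvd_mult_right_iff)
  then obtain h where h: "q = B * h" by (rule dvdE)
  have "p * B = (A * h) * B" using e h by (simp add: ac_simps)
  hence "p = A * h" using assms(3) by simp
  thus thesis using h that by blast
qed

text \<open>
  Any representation by a fraction whose denominator does not vanish at the point may be used here, so
  that sums, products and shifts can be evaluated without finding the reduced fraction.
\<close>

definition has_value :: "complex poly fract \<Rightarrow> complex \<Rightarrow> complex \<Rightarrow> bool" where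
  "has_value F x y \<longleftrightarrow> (\<exists>p q. F = Fract p q \<and> poly q x \<noteq> 0 \<and> y = poly p x / poly q x)"

lemma has_valueI: "poly q x \<noteq> 0 \<Longrightarrow> has_value (Fract p q) x (poly p x / poly q x)"
  unfolding has_value_def by blast

text \<open>
  Cancelling a common factor can only remove zeros of the denominator.
\<close>

lemma has_value_quot_of_fract:
  assumes "has_value F x y"
  shows "poly (snd (quot_of_fract F)) x \<noteq> 0"
    and "y = poly (fst (quot_of_fract F)) x / poly (snd (quot_of_fract F)) x"
proof -
  obtain p q where F: "F = Fract p q" and q: "poly q x \<noteq> 0" and y: "y = poly p x / poly q x"
    using assms unfolding has_value_def by blast
  obtain h where "p = fst (quot_of_fract F) * h" "q = snd (quot_of_fract F) * h"
  proof (rule fract_eq_coprimeE)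
    show "Fract p q = Fract (fst (quot_of_fract F)) (snd (quot_of_fract F))" using F by simp
    show "q \<noteq> 0" using q by auto
  qed (auto intro: coprime_quot_of_fract)
  thus "poly (snd (quot_of_fract F)) x \<noteq> 0"
    and "y = poly (fst (quot_of_fract F)) x / poly (snd (quot_of_fract F)) x"
    using q y by auto
qed

lemma ratfun_eval_eq: "has_value F x y \<Longrightarrow> ratfun_eval F x = y"
  using has_value_quot_of_fract(2) unfolding ratfun_eval_def by simp

lemma has_value_add:
  assumes "has_value F x a" "has_value G x b"
  shows "has_value (F + G) x (a + b)"
proof -
  obtain p q where F: "F = Fract p q" "poly q x \<noteq> 0" "a = poly p x / poly q x"
    using assms(1) unfolding has_value_def by blast
  obtain r s where G: "G = Fract r s" "poly s x \<noteq> 0" "b = poly r x / poly s x"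
    using assms(2) unfolding has_value_def by blast
  have "q \<noteq> 0" "s \<noteq> 0" using F(2) G(2) by auto
  hence "F + G = Fract (p * s + r * q) (q * s)" using F(1) G(1) by simp
  moreover have "a + b = poly (p * s + r * q) x / poly (q * s) x"
    using F G by (simp add: add_frac_eq)
  moreover have "poly (q * s) x \<noteq> 0" using F(2) G(2) by simp
  ultimately show ?thesis unfolding has_value_def by blast
qed

lemma has_value_mult:
  assumes "has_value F x a" "has_value G x b"
  shows "has_value (F * G) x (a * b)"
proof -
  obtain p q where F: "F = Fract p q" "poly q x \<noteq> 0" "a = poly p x / poly q x"
    using assms(1) unfolding has_value_def by blast
  obtain r s where G: "G = Fract r s" "poly s x \<noteq> 0" "b = poly r x / poly s x"
    using assms(2) unfolding has_value_def by blast
  have "F * G = Fract (p * r) (q * s)" using F(1) G(1) by simp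
  moreover have "a * b = poly (p * r) x / poly (q * s) x"
    using F G by simp
  moreover have "poly (q * s) x \<noteq> 0" using F(2) G(2) by simp
  ultimately show ?thesis unfolding has_value_def by blast
qed

lemma has_value_to_fract: "has_value (to_fract p) x (poly p x)"
  using has_valueI[of 1 x p] by (simp add: to_fract_def)

lemma has_value_diff:
  assumes "has_value F x a" "has_value G x b"
  shows "has_value (F - G) x (a - b)"
proof -
  have "has_value (to_fract (-1) * G) x (-1 * b)"
    using has_value_mult[OF has_value_to_fract[of "-1" x] assms(2)] by simp
  from has_value_add[OF assms(1) this] show ?thesis by simp
qed

lemma has_value_ratfun_shift:
  assumes "has_value F (x + a) y"
  shows "has_value (ratfun_shift a F) x y"
  unfolding ratfun_shift_def has_value_def
  using has_value_quot_of_fract[OF assms]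
  by (intro exI[of _ "fst (quot_of_fract F) \<circ>\<^sub>p [:a, 1:]"] exI[of _ "snd (quot_of_fract F) \<circ>\<^sub>p [:a, 1:]"])
    (simp add: poly_pcompose add.commute)

section \<open>Evaluation of bivariate polynomials and of their quotients\<close>

lemma eval_bivar_simps [simp]:
  "eval_bivar bivar_u x y = x"
  "eval_bivar bivar_s x y = y"
  "eval_bivar (bivar_const a) x y = a"
  "eval_bivar (N + M) x y = eval_bivar N x y + eval_bivar M x y"
  "eval_bivar (N - M) x y = eval_bivar N x y - eval_bivar M x y"
  "eval_bivar (N * M) x y = eval_bivar N x y * eval_bivar M x y"
  "eval_bivar 0 x y = 0"
  "eval_bivar [:D:] x y = poly D y"
  by (simp_all add: eval_bivar_def bivar_u_def bivar_s_def bivar_const_def)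

lemma compose_bivar_pCons:
  "compose_bivar (pCons a q) g = bivar_const a + g * compose_bivar q g"
  unfolding compose_bivar_def by (subst map_poly_pCons) (auto simp: bivar_const_def)

lemma compose_bivar_0 [simp]: "compose_bivar 0 g = 0"
  by (simp add: compose_bivar_def)

lemma eval_compose_bivar [simp]: "eval_bivar (compose_bivar q g) x y = poly q (eval_bivar g x y)"
  by (induction q) (simp_all add: compose_bivar_pCons)

lemma poly_poly_eq_eval_bivar: "poly (poly N p) y = eval_bivar N (poly p y) y"
  by (induction N) (simp_all add: eval_bivar_def)

text \<open>
  A divisor of a polynomial in \<open>s\<close> alone is itself a polynomial in \<open>s\<close>, and it then divides every
  coefficient of \<open>N\<close> as a polynomial in \<open>u\<close>, in particular the leading one.
\<close>

lemma coprime_const_if_lead_coeff_const: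
  fixes N :: "complex poly poly"
  assumes "lead_coeff N = [:a:]" "a \<noteq> 0" "D \<noteq> 0"
  shows "coprime N [:D:]"
proof (rule coprimeI)
  fix g assume g: "g dvd N" "g dvd [:D:]"
  have "degree g \<le> degree [:D:]"
    by (rule dvd_imp_degree_le[OF g(2)]) (use assms(3) in simp)
  hence "degree g = 0" by simp
  then obtain g0 where g0: "g = [:g0:]" by (rule degree_eq_zeroE)
  obtain h where "N = g * h" using g(1) by (rule dvdE)
  hence "[:a:] = lead_coeff g * lead_coeff h" using assms(1) lead_coeff_mult by metis
  hence "[:a:] = g0 * lead_coeff h" using g0 by simp
  hence "g0 dvd [:a:]" by (rule dvdI)
  moreover have "is_unit [:a:]" using assms(2) by (simp add: is_unit_const_poly_iff dvd_field_iff)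
  ultimately have "is_unit g0" by (rule dvd_trans)
  thus "is_unit g" by (simp add: g0 is_unit_const_poly_iff)
qed

text \<open>
  The given fraction arises from the reduced one by a factor \<open>h\<close> that divides a polynomial in \<open>s\<close>
  alone. Hence \<open>h\<close> cannot vanish under the substitution for \<open>u\<close>, and it cancels again afterwards.
\<close>

lemma diag_shift_Fract:
  assumes "D \<noteq> 0"
  shows "diag_shift a (Fract N [:D:]) = Fract (poly N [:a, 1:]) D"
proof -
  let ?Q = "quot_of_fract (Fract N [:D:])"
  obtain h where h: "N = fst ?Q * h" "[:D:] = snd ?Q * h"
    by (rule fract_eq_coprimeE[of N "[:D:]" "fst ?Q" "snd ?Q"]) (use assms in \<open>auto intro: coprime_quot_of_fract\<close>)
  have D: "D = poly (snd ?Q) [:a, 1:] * poly h [:a, 1:]"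
    by (metis h(2) poly_const_conv poly_mult)
  have N: "poly N [:a, 1:] = poly (fst ?Q) [:a, 1:] * poly h [:a, 1:]"
    by (metis h(1) poly_mult)
  show ?thesis unfolding diag_shift_def
    by (subst eq_fract) (use D N assms in \<open>auto simp: algebra_simps\<close>)
qed

lemma has_value_inverse_diag_shift:
  assumes "D \<noteq> 0" "eval_bivar N (x + a) x \<noteq> 0"
  shows "has_value (inverse (diag_shift a (Fract N [:D:]))) x (poly D x / eval_bivar N (x + a) x)"
  using has_valueI[of "poly N [:a, 1:]" x D] assms
  by (simp add: diag_shift_Fract poly_poly_eq_eval_bivar add.commute)

section \<open>Expansions in the Newtonian basis\<close>

lemma degree_lead_coeff_newton_basis:
  "degree (newton_basis R k) = k \<and> lead_coeff (newton_basis R k) = 1"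
proof (induction k)
  case (Suc k)
  have eq: "newton_basis R (Suc k) = [:poly R (of_nat k), 1:] * newton_basis R k"
    by (simp add: algebra_simps)
  have "newton_basis R k \<noteq> 0" using Suc by auto
  hence "degree ([:poly R (of_nat k), 1:] * newton_basis R k) = Suc k"
    using Suc by (subst degree_mult_eq) auto
  moreover have "lead_coeff ([:poly R (of_nat k), 1:] * newton_basis R k) = 1"
    using Suc by (subst lead_coeff_mult) auto
  ultimately show ?case unfolding eq by simp
qed simp

lemma coeff_newton_sum_top: "coeff (\<Sum>k\<le>n. smult (a k) (newton_basis R k)) n = a n"
proof -
  have "coeff (newton_basis R k) n = (if k = n then 1 else 0)" if "k \<le> n" for k
    using degree_lead_coeff_newton_basis[of R k] that by (auto intro!: coeff_eq_0)
  hence "coeff (\<Sum>k\<le>n. smult (a k) (newton_basis R k)) n = (\<Sum>k\<le>n. if k = n then a k else 0)"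
    unfolding coeff_sum by (intro sum.cong) auto
  thus ?thesis by simp
qed

lemma degree_newton_sum_le: "degree (\<Sum>k\<le>n. smult (a k) (newton_basis R k)) \<le> n"
  using degree_lead_coeff_newton_basis[of R]
  by (intro degree_sum_le) (auto intro: order.trans[OF degree_smult_le])

lemma smult_sum_right: "smult a (\<Sum>k\<in>S. p k) = (\<Sum>k\<in>S. smult a (p k))"
  by (induction S rule: infinite_finite_induct) (simp_all add: smult_add_right)

text \<open>
  Linear independence of the Newtonian basis, read off from the leading coefficients.
\<close>

lemma newton_sum_eq_0:
  "(\<Sum>k\<le>n. smult (a k) (newton_basis R k)) = 0 \<Longrightarrow> k \<le> n \<Longrightarrow> a k = 0"
proof (induction n)
  case (Suc n)
  have top: "a (Suc n) = 0" using coeff_newton_sum_top[of a R "Suc n"] unfolding Suc.prems(1) by simp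
  hence "(\<Sum>k\<le>n. smult (a k) (newton_basis R k)) = 0" using Suc.prems(1) by simp
  thus ?case using Suc.IH Suc.prems(2) top by (cases "k = Suc n") auto
qed simp

lemma poly_family_iff_diag:
  assumes "newton_coeffs R P c"
  shows "poly_family P \<longleftrightarrow> (\<forall>n\<ge>0. c n n = 1)"
proof -
  have P: "P n = (\<Sum>k\<le>n. smult (c (int n) (int k)) (newton_basis R k))" for n
    using assms unfolding newton_coeffs_def by blast
  have top: "coeff (P n) n = c (int n) (int n)" for n unfolding P by (rule coeff_newton_sum_top)
  have deg: "degree (P n) \<le> n" for n unfolding P by (rule degree_newton_sum_le)
  show ?thesis
  proof
    assume "poly_family P"
    hence "c (int n) (int n) = 1" for n unfolding poly_family_def top[symmetric] by metis
    thus "\<forall>n\<ge>0. c n n = 1" by (metis nonneg_int_cases)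
  next
    assume "\<forall>n\<ge>0. c n n = 1"
    hence 1: "coeff (P n) n = 1" for n unfolding top by simp
    hence "degree (P n) = n" for n using deg[of n] le_degree[of "P n" n] by simp
    thus "poly_family P" unfolding poly_family_def using 1 by simp
  qed
qed

lemma mult_z_newton_sum:
  assumes "newton_coeffs R P c"
  shows "[:0, 1:] * P n = (\<Sum>k\<le>Suc n. smult (c (int n) (int k - 1) - poly R (of_nat k) * c (int n) (int k)) (newton_basis R k))"
proof -
  let ?N = "newton_basis R"
  have P: "P n = (\<Sum>k\<le>n. smult (c (int n) (int k)) (?N k))"
    and c0: "\<And>n k. \<not> (n \<ge> k \<and> k \<ge> 0) \<Longrightarrow> c n k = 0"
    using assms unfolding newton_coeffs_def by blast+
  have "[:0, 1:] * P n = (\<Sum>k\<le>n. smult (c (int n) (int k)) ([:0, 1:] * ?N k))"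
    unfolding P sum_distrib_left by (intro sum.cong) (simp_all only: mult_smult_right)
  also have "\<dots> = (\<Sum>k\<le>n. smult (c (int n) (int k)) (?N (Suc k)) - smult (poly R (of_nat k) * c (int n) (int k)) (?N k))"
    by (intro sum.cong refl) (simp add: smult_add_right mult.commute)
  also have "\<dots> = (\<Sum>k\<le>n. smult (c (int n) (int k)) (?N (Suc k)))
      - (\<Sum>k\<le>n. smult (poly R (of_nat k) * c (int n) (int k)) (?N k))"
    by (rule sum_subtractf)
  also have "(\<Sum>k\<le>n. smult (c (int n) (int k)) (?N (Suc k))) = (\<Sum>k\<le>Suc n. smult (c (int n) (int k - 1)) (?N k))"
    unfolding sum.atMost_Suc_shift[of _ n] by (simp add: c0)
  also have "(\<Sum>k\<le>n. smult (poly R (of_nat k) * c (int n) (int k)) (?N k))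
      = (\<Sum>k\<le>Suc n. smult (poly R (of_nat k) * c (int n) (int k)) (?N k))"
    by (simp add: c0)
  finally show ?thesis by (simp only: smult_diff_left sum_subtractf)
qed

text \<open>
  All three polynomials on the right are written as sums over \<open>k \<le> n + 1\<close>, which is possible because
  \<open>c\<close> vanishes outside the triangle. For \<open>n = 0\<close> the row with index \<open>-1\<close> is zero, which accounts for
  the missing term \<open>P\<^sub>-\<^sub>1\<close>.
\<close>

lemma recurrence_of_coefficients:
  assumes "newton_coeffs R P c"
    and id: "\<And>k. 0 \<le> k \<Longrightarrow> k \<le> int n + 1 \<Longrightarrow>
      c n (k - 1) - poly R (of_int k) * c n k = c (int n + 1) k + a * c n k + b * c (int n - 1) k"
  shows "[:0, 1:] * P n = P (n + 1) + smult a (P n) + (if n = 0 then 0 else smult b (P (n - 1)))"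
proof -
  let ?N = "newton_basis R"
  have P: "P n = (\<Sum>k\<le>n. smult (c (int n) (int k)) (?N k))"
    and c0: "\<And>n k. \<not> (n \<ge> k \<and> k \<ge> 0) \<Longrightarrow> c n k = 0" for n
    using assms(1) unfolding newton_coeffs_def by blast+
  have pad: "(\<Sum>k\<le>m. smult (c (int m) (int k)) (?N k)) = (\<Sum>k\<le>M. smult (c (int m) (int k)) (?N k))"
    if "m \<le> M" for m M
    by (rule sum.mono_neutral_left) (use that in \<open>auto simp: c0\<close>)
  have Pn: "P n = (\<Sum>k\<le>Suc n. smult (c (int n) (int k)) (?N k))"
    unfolding P by (rule pad) simp
  have PS: "P (n + 1) = (\<Sum>k\<le>Suc n. smult (c (int n + 1) (int k)) (?N k))"
    unfolding P by (simp add: add.commute)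
  have Pp: "(if n = 0 then 0 else smult b (P (n - 1))) = smult b (\<Sum>k\<le>Suc n. smult (c (int n - 1) (int k)) (?N k))"
  proof (cases "n = 0")
    case True thus ?thesis by (simp add: c0)
  next
    case False
    hence "P (n - 1) = (\<Sum>k\<le>Suc n. smult (c (int n - 1) (int k)) (?N k))"
      unfolding P using pad[of "n - 1" "Suc n"] by simp
    thus ?thesis using False by simp
  qed
  have "[:0, 1:] * P n = (\<Sum>k\<le>Suc n. smult (c (int n + 1) (int k) + a * c (int n) (int k) + b * c (int n - 1) (int k)) (?N k))"
    unfolding mult_z_newton_sum[OF assms(1)]
  proof (intro sum.cong refl)
    fix k assume "k \<in> {..Suc n}"
    thus "smult (c (int n) (int k - 1) - poly R (of_nat k) * c (int n) (int k)) (?N k)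
      = smult (c (int n + 1) (int k) + a * c (int n) (int k) + b * c (int n - 1) (int k)) (?N k)"
      using id[of "int k"] by simp
  qed
  also have "\<dots> = (\<Sum>k\<le>Suc n. smult (c (int n + 1) (int k)) (?N k))
      + smult a (\<Sum>k\<le>Suc n. smult (c (int n) (int k)) (?N k))
      + smult b (\<Sum>k\<le>Suc n. smult (c (int n - 1) (int k)) (?N k))"
    unfolding smult_sum_right sum.distrib[symmetric] by (simp only: smult_add_left smult_smult)
  finally show ?thesis unfolding Pp unfolding PS Pn[symmetric] .
qed

section \<open>Arrays of hypergeometric coefficients\<close>

text \<open>
  The relation \<open>D(k) c(n, k + 1) = N(n, k) c(n, k)\<close> with the values of \<open>D\<close> and \<open>N\<close> at integers in
  place of the polynomials: the identity for the coefficients uses nothing else.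
\<close>

locale hypergeometric_array =
  fixes c :: "int \<Rightarrow> int \<Rightarrow> complex"
    and d :: "int \<Rightarrow> complex"
    and m :: "int \<Rightarrow> int \<Rightarrow> complex"
  assumes c_diag: "0 \<le> n \<Longrightarrow> c n n = 1"
    and c_outside: "\<not> (0 \<le> k \<and> k \<le> n) \<Longrightarrow> c n k = 0"
    and relation: "d k * c n (k + 1) = m n k * c n k"
    and m_nonzero: "0 \<le> k \<Longrightarrow> k < n \<Longrightarrow> m n k \<noteq> 0"
begin

lemma c_step: "m n k \<noteq> 0 \<Longrightarrow> c n k = d k / m n k * c n (k + 1)"
  using relation[of k n] by (simp add: field_simps)

lemma c_below_diag: "0 \<le> n \<Longrightarrow> c (n + 1) n = d n / m (n + 1) n"
  using c_step[of "n + 1" n] by (simp add: m_nonzero c_diag)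

text \<open>
  Both rows satisfy first order relations with the same factor \<open>d k\<close>. So their quotient changes from
  \<open>k\<close> to \<open>k + 1\<close> by the factor \<open>m n k / m (n - 1) k\<close>, from which \<open>d\<close> has disappeared; the values on
  the diagonal fix it.
\<close>

lemma row_ratio:
  assumes start: "A (n - 1) = c n (n - 1)"
    and step: "\<And>k. 0 \<le> k \<Longrightarrow> k < n - 1 \<Longrightarrow> A (k + 1) * m (n - 1) k = A k * m n k"
    and "0 \<le> k" "k \<le> n - 1"
  shows "c n k = A k * c (n - 1) k"
  using assms(4,3)
proof (induction k rule: int_le_induct)
  case base
  thus ?case using start c_diag by simp
next
  case (step i)
  have nz: "m n (i - 1) \<noteq> 0" "m (n - 1) (i - 1) \<noteq> 0"
    using step m_nonzero[of "i - 1" n] m_nonzero[of "i - 1" "n - 1"] by auto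
  have "c n (i - 1) = d (i - 1) / m n (i - 1) * (A i * c (n - 1) i)"
    using c_step[OF nz(1)] step by simp
  also have "\<dots> = (A i * m (n - 1) (i - 1) / m n (i - 1)) * (d (i - 1) / m (n - 1) (i - 1) * c (n - 1) i)"
    using nz by simp
  also have "A i * m (n - 1) (i - 1) = A (i - 1) * m n (i - 1)"
    using assms(2)[of "i - 1"] step by simp
  also have "d (i - 1) / m (n - 1) (i - 1) * c (n - 1) i = c (n - 1) (i - 1)"
    using c_step[OF nz(2)] by simp
  finally show ?case using nz by simp
qed

text \<open>
  The only possible value of \<open>\<alpha>\<^sub>n\<close>, obtained by comparing coefficients at \<open>k = n\<close>.
\<close>

definition diag_coeff :: "(int \<Rightarrow> complex) \<Rightarrow> int \<Rightarrow> complex" where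
  "diag_coeff r n = c n (n - 1) - c (n + 1) n - r n"

text \<open>
  The coefficient \<open>b\<close> can be left unspecified: the case \<open>k = n - 1\<close> determines it.
\<close>

definition three_term :: "(int \<Rightarrow> complex) \<Rightarrow> int \<Rightarrow> bool" where
  "three_term r n \<longleftrightarrow> (\<exists>b. \<forall>k. 0 \<le> k \<longrightarrow> k \<le> n - 1 \<longrightarrow>
     c n (k - 1) - r k * c n k = c (n + 1) k + diag_coeff r n * c n k + b * c (n - 1) k)"

lemma three_term_1: "three_term r 1"
  unfolding three_term_def
proof (intro exI allI impI)
  fix k :: int assume "0 \<le> k" "k \<le> 1 - 1"
  hence "k = 0" by simp
  thus "c 1 (k - 1) - r k * c 1 k = c (1 + 1) k + diag_coeff r 1 * c 1 k
    + (c 1 (-1) - r 0 * c 1 0 - c 2 0 - diag_coeff r 1 * c 1 0) * c (1 - 1) k"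
    using c_diag[of 0] by simp
qed

text \<open>
  With \<open>A k = c n k / c (n - 1) k\<close> and \<open>A' k = c (n + 1) k / c n k\<close> the desired identity is
  \<open>c (n - 1) k\<close> times a relation between functions of \<open>k\<close> that are known explicitly. The
  value \<open>m n (-1)\<close> enters through \<open>k = 0\<close>, where \<open>c n (-1)\<close> has to be given by the same formula as
  the other terms \<open>c n (k - 1)\<close>.
\<close>

lemma three_termI:
  assumes "2 \<le> n" "m n (- 1) \<noteq> 0"
    and A_start: "A (n - 1) = c n (n - 1)"
    and A_step: "\<And>k. 0 \<le> k \<Longrightarrow> k < n - 1 \<Longrightarrow> A (k + 1) * m (n - 1) k = A k * m n k"
    and A'_start: "A' n = c (n + 1) n"
    and A'_step: "\<And>k. 0 \<le> k \<Longrightarrow> k < n \<Longrightarrow> A' (k + 1) * m n k = A' k * m (n + 1) k"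
    and identity: "\<And>k. 0 \<le> k \<Longrightarrow> k \<le> n - 1 \<Longrightarrow>
      A k * (d (k - 1) / m n (k - 1) - r k - diag_coeff r n - A' k) = b"
  shows "three_term r n"
  unfolding three_term_def
proof (intro exI[of _ b] allI impI)
  fix k assume k: "0 \<le> k" "k \<le> n - 1"
  have 1: "c n k = A k * c (n - 1) k"
    by (rule row_ratio) (use A_start A_step k in auto)
  have 2: "c (n + 1) k = A' k * c n k"
    using row_ratio[of A' "n + 1" k] A'_start A'_step k by simp
  have "m n (k - 1) \<noteq> 0"
    using assms(2) m_nonzero[of "k - 1" n] k by (cases "k = 0") auto
  hence 3: "c n (k - 1) = d (k - 1) / m n (k - 1) * c n k"
    using c_step[of n "k - 1"] by simp
  have "c n (k - 1) - r k * c n k - c (n + 1) k - diag_coeff r n * c n k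
    = A k * (d (k - 1) / m n (k - 1) - r k - diag_coeff r n - A' k) * c (n - 1) k"
    unfolding 2 3 unfolding 1 by (simp add: algebra_simps)
  thus "c n (k - 1) - r k * c n k = c (n + 1) k + diag_coeff r n * c n k + b * c (n - 1) k"
    unfolding identity[OF k] by (simp add: algebra_simps)
qed

text \<open>
  The only possible value of \<open>\<beta>\<^sub>n\<^sub>-\<^sub>1\<close>, obtained by comparing coefficients at \<open>k = n - 1\<close>.
\<close>

definition off_coeff :: "(int \<Rightarrow> complex) \<Rightarrow> int \<Rightarrow> complex" where
  "off_coeff r n = c n (n - 2) - r (n - 1) * c n (n - 1) - c (n + 1) (n - 1) - diag_coeff r n * c n (n - 1)"

lemma three_term_everywhere:
  assumes "0 \<le> n" "n = 0 \<or> three_term r n" "0 \<le> k" "k \<le> n + 1"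
  shows "c n (k - 1) - r k * c n k = c (n + 1) k + diag_coeff r n * c n k + off_coeff r n * c (n - 1) k"
proof -
  consider "k = n + 1" | "k = n" | "k \<le> n - 1" using assms(4) by linarith
  thus ?thesis
  proof cases
    case 1 thus ?thesis using assms(1) by (simp add: c_diag c_outside)
  next
    case 2 thus ?thesis using assms(1) by (simp add: c_diag c_outside diag_coeff_def)
  next
    case 3
    hence "three_term r n" using assms by auto
    then obtain b where b: "\<And>k. 0 \<le> k \<Longrightarrow> k \<le> n - 1 \<Longrightarrow>
        c n (k - 1) - r k * c n k = c (n + 1) k + diag_coeff r n * c n k + b * c (n - 1) k"
      unfolding three_term_def by blast
    have "b = off_coeff r n" using b[of "n - 1"] 3 assms(3) by (simp add: c_diag off_coeff_def algebra_simps)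
    thus ?thesis using b[OF assms(3) 3] by simp
  qed
qed

end

section \<open>The identity when numerators have degree at most two\<close>

lemma interpolation_quadratic:
  fixes n x :: complex
  assumes B: "\<And>x. B x = e0 + e1 * x + e2 * x ^ 2" and "B n = 0" "B (n + 1) = 0"
  shows "B x = e2 * (n - x) * (n + 1 - x)"
proof -
  have 1: "e1 + e2 * (2 * n + 1) = B (n + 1) - B n"
    unfolding B by (simp add: algebra_simps power2_eq_square)
  hence "e1 + e2 * (2 * n + 1) = 0" unfolding assms(2,3) by simp
  hence e1: "e1 = - (e2 * (2 * n + 1))" by (simp only: eq_neg_iff_add_eq_0)
  have "e0 + (e1 * n + e2 * n ^ 2) = 0" using assms(2) unfolding B by (simp only: add.assoc)
  hence e0: "e0 = - (e1 * n + e2 * n ^ 2)" by (simp only: eq_neg_iff_add_eq_0)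
  show ?thesis unfolding B e0 e1 by (simp add: algebra_simps power2_eq_square)
qed

text \<open>
  The polynomial on the left has degree at most four. Its terms of degree four and three come from
  \<open>- D (x - 1)\<close> and \<open>- r x * (n + 1 - x) * q (n + x - 1)\<close> alone, and they cancel: this is the purpose
  of the summand \<open>s q(s) (R(s + 1) - R(0))\<close> in the denominator of \<open>f\<close>.
\<close>

lemma bracket_quadratic:
  fixes q0 q1 r0 r1 r2 v0 v1 al K n :: complex
  defines "q \<equiv> \<lambda>t. q0 + q1 * t" and "r \<equiv> \<lambda>t. r0 + r1 * t + r2 * t ^ 2" and "v \<equiv> \<lambda>t. v0 + v1 * t"
  defines "D \<equiv> \<lambda>t. t * q t * (r (t + 1) - r 0) + (t + 1) * v t"
  obtains e0 e1 e2 where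
    "\<And>x. - D (x - 1) - (r x + al) * (n + 1 - x) * q (n + x - 1) - K * q (n + x) * q (n + x - 1)
       = e0 + e1 * x + e2 * x ^ 2"
proof (rule that)
  fix x
  let ?B = "\<lambda>x. - D (x - 1) - (r x + al) * (n + 1 - x) * q (n + x - 1) - K * q (n + x) * q (n + x - 1)"
  \<comment> \<open>Lagrange interpolation at the points -1, 0 and 1.\<close>
  show "?B x = ?B 0 + (?B 1 - ?B (-1)) / 2 * x + ((?B 1 + ?B (-1)) / 2 - ?B 0) * x ^ 2"
    unfolding D_def q_def r_def v_def by (simp add: field_simps power2_eq_square)
qed

lemma common_denominator:
  fixes D :: complex
  assumes "E \<noteq> 0" "L \<noteq> 0" "Q \<noteq> 0"
  shows "D / (- E * L) - r - al - F * M / (E * Q) = (- D - (r + al) * E * L - F / Q * M * L) / (E * L)"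
  using assms by (simp add: field_simps)

lemma swap_cancel:
  fixes F :: complex
  assumes "u \<noteq> 0" "w \<noteq> 0"
  shows "F * a / (u * Q) * (- u * b) = F * b / (w * Q) * (- w * a)"
  using assms by (cases "Q = 0") (simp_all add: field_simps)

text \<open>
  Here \<open>c(n, k) / c(n - 1, k)\<close> is a constant times \<open>q(n + k - 1) / (n - k)\<close>. After multiplication by
  the denominators the identity concerns the polynomial \<open>B\<close> below, of degree at most two by
  \<open>bracket_quadratic\<close>. It vanishes at \<open>n\<close> and at \<open>n + 1\<close>, which are just the formulas for
  \<open>c(n, n - 1)\<close> and \<open>c(n + 1, n)\<close>; so \<open>B\<close> is a constant multiple of the denominator
  \<open>(n - x)(n + 1 - x)\<close>.
\<close>

lemma (in hypergeometric_array) three_term_quadratic: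
  fixes q0 q1 r0 r1 r2 v0 v1 :: complex
  defines "q \<equiv> \<lambda>t. q0 + q1 * t" and "r \<equiv> \<lambda>t. r0 + r1 * t + r2 * t ^ 2" and "v \<equiv> \<lambda>t. v0 + v1 * t"
  assumes m_eq: "\<And>n k. m n k = (of_int k - of_int n) * q (of_int k + of_int n)"
    and d_eq: "\<And>k. d k = of_int k * q (of_int k) * (r (of_int k + 1) - r 0) + (of_int k + 1) * v (of_int k)"
    and n: "2 \<le> n"
  shows "three_term (\<lambda>k. r (of_int k)) n"
proof -
  define N where "N = (of_int n :: complex)"
  \<comment> \<open>The entries with k = 0 alone show that q has no zero among the positive integers.\<close>
  have q_nz: "q (of_int j) \<noteq> 0" if "1 \<le> j" for j
    using m_nonzero[of 0 j] that unfolding m_eq by simp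
  define D where "D = (\<lambda>t. t * q t * (r (t + 1) - r 0) + (t + 1) * v t)"
  define al where "al = diag_coeff (\<lambda>k. r (of_int k)) n"
  define F where "F = c n (n - 1)"
  define F' where "F' = c (n + 1) n"
  have q1: "q (2 * N - 2) \<noteq> 0" using q_nz[of "2 * n - 2"] n unfolding N_def by simp
  have q2: "q (2 * N - 1) \<noteq> 0" using q_nz[of "2 * n - 1"] n unfolding N_def by simp
  have q3: "q (2 * N) \<noteq> 0" using q_nz[of "2 * n"] n unfolding N_def by simp
  have q4: "q (2 * N + 1) \<noteq> 0" using q_nz[of "2 * n + 1"] n unfolding N_def by simp
  have F: "F * q (2 * N - 1) = - D (N - 1)"
    using c_below_diag[of "n - 1"] q2 n unfolding F_def N_def m_eq d_eq D_def by simp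
  have F': "F' * q (2 * N + 1) = - D N"
    using c_below_diag[of n] q4 n unfolding F'_def N_def m_eq d_eq D_def by simp
  have al: "al = F - F' - r N" unfolding al_def diag_coeff_def F_def F'_def N_def ..
  define B where "B = (\<lambda>x. - D (x - 1) - (r x + al) * (N + 1 - x) * q (N + x - 1)
    - F' / q (2 * N) * q (N + x) * q (N + x - 1))"
  obtain e0 e1 e2 where e: "\<And>x. B x = e0 + e1 * x + e2 * x ^ 2"
    using bracket_quadratic[of q0 q1 r0 r1 r2 v0 v1 al N "F' / q (2 * N)"]
    unfolding B_def D_def q_def r_def v_def by blast
  have "B N = - D (N - 1) - (r N + al + F') * q (2 * N - 1)"
    unfolding B_def using q3 by (simp add: mult_2[symmetric] algebra_simps)
  hence BN: "B N = 0" using F unfolding al by simp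
  have "B (N + 1) = - D N - F' / q (2 * N) * q (2 * N + 1) * q (2 * N)"
    unfolding B_def by (simp add: mult_2[symmetric] add.assoc)
  hence BN1: "B (N + 1) = 0" using F' q3 by (simp add: mult.commute)
  have B: "B x = e2 * (N - x) * (N + 1 - x)" for x
    by (rule interpolation_quadratic[OF e BN BN1])
  show ?thesis
  proof (rule three_termI[where A = "\<lambda>k. F * q (N + of_int k - 1) / ((N - of_int k) * q (2 * N - 2))"
        and A' = "\<lambda>k. F' * q (N + of_int k) / ((N + 1 - of_int k) * q (2 * N))"
        and b = "F * e2 / q (2 * N - 2)"])
    have "m n (- 1) = - of_int (n + 1) * q (of_int (n - 1))"
      unfolding m_eq by simp
    moreover have "of_int (n + 1) \<noteq> (0 :: complex)" using n by (subst of_int_eq_0_iff) simp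
    ultimately show "m n (- 1) \<noteq> 0"
      using q_nz[of "n - 1"] n by (simp del: of_int_add of_int_diff)
  next
    have "N + of_int (n - 1) - 1 = 2 * N - 2" "N - of_int (n - 1) = 1"
      unfolding N_def by simp_all
    thus "F * q (N + of_int (n - 1) - 1) / ((N - of_int (n - 1)) * q (2 * N - 2)) = c n (n - 1)"
      using q1 unfolding F_def by simp
  next
    have "N + of_int n = 2 * N" "N + 1 - of_int n = 1"
      unfolding N_def by simp_all
    thus "F' * q (N + of_int n) / ((N + 1 - of_int n) * q (2 * N)) = c (n + 1) n"
      using q3 unfolding F'_def by simp
  next
    fix k assume k: "0 \<le> k" "k < n - 1"
    define x where "x = (of_int k :: complex)"
    have "of_int (n - k) \<noteq> (0 :: complex)" "of_int (n - 1 - k) \<noteq> (0 :: complex)"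
      using k by (simp_all only: of_int_eq_0_iff)
    hence nz: "N - x \<noteq> 0" "N - 1 - x \<noteq> 0" unfolding N_def x_def by simp_all
    have m: "m (n - 1) k = - (N - 1 - x) * q (N + x - 1)" "m n k = - (N - x) * q (N + x)"
      unfolding m_eq N_def x_def by (simp_all add: algebra_simps)
    have k1: "N + of_int (k + 1) - 1 = N + x" "N - of_int (k + 1) = N - 1 - x"
      unfolding x_def by simp_all
    show "F * q (N + of_int (k + 1) - 1) / ((N - of_int (k + 1)) * q (2 * N - 2)) * m (n - 1) k
      = F * q (N + of_int k - 1) / ((N - of_int k) * q (2 * N - 2)) * m n k"
      unfolding k1 m x_def[symmetric] by (rule swap_cancel[OF nz(2,1)])
  next
    fix k assume k: "0 \<le> k" "k < n"
    define x where "x = (of_int k :: complex)"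
    have "of_int (n + 1 - k) \<noteq> (0 :: complex)" "of_int (n - k) \<noteq> (0 :: complex)"
      using k by (simp_all only: of_int_eq_0_iff)
    hence nz: "N + 1 - x \<noteq> 0" "N - x \<noteq> 0" unfolding N_def x_def by simp_all
    have m: "m n k = - (N - x) * q (N + x)" "m (n + 1) k = - (N + 1 - x) * q (N + x + 1)"
      unfolding m_eq N_def x_def by (simp_all add: algebra_simps)
    have k1: "N + of_int (k + 1) = N + x + 1" "N + 1 - of_int (k + 1) = N - x"
      unfolding x_def by simp_all
    show "F' * q (N + of_int (k + 1)) / ((N + 1 - of_int (k + 1)) * q (2 * N)) * m n k
      = F' * q (N + of_int k) / ((N + 1 - of_int k) * q (2 * N)) * m (n + 1) k"
      unfolding k1 m x_def[symmetric] by (rule swap_cancel[OF nz(2,1)])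
  next
    fix k assume k: "0 \<le> k" "k \<le> n - 1"
    define x where "x = (of_int k :: complex)"
    have "of_int (n - k) \<noteq> (0 :: complex)" "of_int (n + 1 - k) \<noteq> (0 :: complex)"
      using k by (simp_all only: of_int_eq_0_iff)
    hence nz: "N - x \<noteq> 0" "N + 1 - x \<noteq> 0" "q (N + x - 1) \<noteq> 0"
      using k n q_nz[of "n + k - 1"] unfolding N_def x_def by simp_all
    have dm: "d (k - 1) = D (x - 1)" "m n (k - 1) = - (N + 1 - x) * q (N + x - 1)"
      unfolding d_eq m_eq D_def x_def N_def by (simp_all add: algebra_simps)
    have "(D (x - 1) / (- (N + 1 - x) * q (N + x - 1)) - r x - al
       - F' * q (N + x) / ((N + 1 - x) * q (2 * N))) = B x / ((N + 1 - x) * q (N + x - 1))"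
      unfolding B_def by (rule common_denominator[OF nz(2,3) q3])
    also have "\<dots> = e2 * (N - x) / q (N + x - 1)" unfolding B using nz by simp
    finally show "F * q (N + of_int k - 1) / ((N - of_int k) * q (2 * N - 2)) *
        (d (k - 1) / m n (k - 1) - r (of_int k) - diag_coeff (\<lambda>k. r (of_int k)) n -
         F' * q (N + of_int k) / ((N + 1 - of_int k) * q (2 * N))) = F * e2 / q (2 * N - 2)"
      unfolding dm al_def[symmetric] x_def[symmetric] using nz q1 by simp
  qed (use n in auto)
qed

section \<open>The identity when numerators have degree four\<close>

text \<open>
  Substituting \<open>a = k - 1 - n\<close>, \<open>g = k - n - s\<close> and \<open>w = 2 n + s + e\<close> reveals the structure: the four
  factors of \<open>N(n, k - 1)\<close> become \<open>a\<close>, \<open>g\<close>, \<open>g + w\<close> and \<open>a + w\<close>, and for \<open>e = 0\<close> as well as for \<open>e = 1\<close> the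
  value \<open>4 D(k - 1)\<close> is \<open>(a + g + w) (a + g + w + 1)\<close>.
\<close>

lemma quartic_identity:
  fixes a g w :: complex
  shows "(a + g + w) * (a + g + w + 1) * ((w - 1) * w * (w + 1)) + 2 * w * (a * g * (g + w) * (a + w))
      - (w - 1) * ((g + w + 1) * (a + w + 1) * ((g + w) * (a + w))) = (w + 1) * ((a + 1) * (g + 1) * (a * g))"
  by (simp add: algebra_simps)

lemma quartic_identity_divided:
  fixes l w a g h i y :: complex
  assumes id: "4 * y * (w' * w * w'') + 2 * w * (a * g * h * i)
      - w' * (h' * i' * (h * i)) = w'' * (a' * g' * (a * g))"
    and nz: "l \<noteq> 0" "w' \<noteq> 0" "w \<noteq> 0" "w'' \<noteq> 0" "a \<noteq> 0" "g \<noteq> 0" "h \<noteq> 0" "i \<noteq> 0"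
  shows "y / (l * a * g * h * i) + 1 / (2 * l * w' * w'')
      - h' * i' / (4 * l * w * w'' * (a * g)) = a' * g' / (4 * l * w' * w * (h * i))"
proof -
  define C where "C = 4 * l * w' * w * w'' * (a * g * h * i)"
  have "y / (l * a * g * h * i) = 4 * y * (w' * w * w'') / C"
    unfolding C_def using nz by (simp add: frac_eq_eq ac_simps)
  moreover have "1 / (2 * l * w' * w'') = 2 * w * (a * g * h * i) / C"
    unfolding C_def using nz by (simp add: frac_eq_eq ac_simps)
  moreover have "h' * i' / (4 * l * w * w'' * (a * g)) = w' * (h' * i' * (h * i)) / C"
    unfolding C_def using nz by (simp add: frac_eq_eq ac_simps)
  moreover have "a' * g' / (4 * l * w' * w * (h * i)) = w'' * (a' * g' * (a * g)) / C"
    unfolding C_def using nz by (simp add: frac_eq_eq ac_simps)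
  ultimately show ?thesis unfolding id[symmetric] by (simp add: diff_divide_distrib add_divide_distrib)
qed

lemma first_coeff_difference:
  fixes l s :: complex
  assumes "p * w'' - q * w' = - 2 * s" "l \<noteq> 0" "s \<noteq> 0" "w' \<noteq> 0" "w'' \<noteq> 0"
  shows "p / (4 * l * s * w') - q / (4 * l * s * w'') = - (1 / (2 * l * w' * w''))"
proof -
  have "p / (4 * l * s * w') - q / (4 * l * s * w'') = (p * w'' - q * w') / (4 * l * s * w' * w'')"
    using assms(2-) by (simp add: diff_divide_distrib)
  thus ?thesis unfolding assms(1) using assms(2-) by simp
qed

lemma cancel_quarter:
  fixes y :: complex
  assumes "4 * y = p * q" "q \<noteq> 0"
  shows "y / (l * s * q * r) = p / (4 * l * s * r)"
proof -
  have y: "y = p * q / 4" using assms(1) by (simp add: eq_divide_eq mult.commute)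
  show ?thesis unfolding y using assms(2) by simp
qed

lemma cancel_factor: "u \<noteq> 0 \<Longrightarrow> p * u / (4 * l * u * v * s) = p / (4 * l * s * v)"
  for u :: complex
  by (simp add: field_simps)

lemma cancel_all:
  fixes l :: complex
  assumes "hi \<noteq> 0" "ag \<noteq> 0"
  shows "hi / (4 * l * u * v * ag) * (ag / (4 * l * v * w * hi)) = 1 / (16 * l ^ 2 * u * v ^ 2 * w)"
  using assms by (simp add: power2_eq_square ac_simps)

lemma swap_cancel4:
  fixes l K :: complex
  assumes "u1 \<noteq> 0" "u2 \<noteq> 0" "w1 \<noteq> 0" "w2 \<noteq> 0"
  shows "a1 * a2 / (K * (u1 * u2)) * (l * u1 * u2 * b1 * b2) = b1 * b2 / (K * (w1 * w2)) * (l * w1 * w2 * a1 * a2)"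
  using assms by (cases "K = 0") (simp_all add: field_simps)

text \<open>
  In terms of \<open>w = 2 n + s + e\<close>, the ratio \<open>c(n + 1, k) / c(n, k)\<close> is
  \<open>(k + n + 1 + e) (k + n + s + e) / (4 l w (w + 1) (k - n - 1) (k - n - s))\<close>,
  and \<open>c(n, n - 1) - c(n + 1, n)\<close> is \<open>- 1 / (2 l (w - 1) (w + 1))\<close>. Inserting both
  reduces the claim to \<open>quartic_identity\<close>.
\<close>

lemma (in hypergeometric_array) three_term_quartic:
  fixes s e l r0 :: complex
  assumes e: "e = 0 \<or> e = 1"
    and m_eq: "\<And>n k. m n k = l * (of_int k - of_int n) * (of_int k - of_int n + 1 - s)
      * (of_int k + of_int n + 1 + e) * (of_int k + of_int n + s + e)"
    and d_eq: "\<And>k. d k = (of_int k + 1) * (of_int k + 1 / 2 + e)"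
    and n: "2 \<le> n"
  shows "three_term (\<lambda>k. r0) n"
proof -
  define N where "N = (of_int n :: complex)"
  have s_nz: "of_int j + s \<noteq> 0" if "0 \<le> j" for j
  proof
    assume "of_int j + s = 0"
    hence "s = - of_int j" by (simp add: eq_neg_iff_add_eq_0 add.commute)
    hence "of_int 0 - of_int (j + 1) + 1 - s = 0" by simp
    hence "m (j + 1) 0 = 0" unfolding m_eq by (simp only: mult_zero_left mult_zero_right)
    thus False using m_nonzero[of 0 "j + 1"] that by simp
  qed
  have se_nz: "of_int j + s + e \<noteq> 0" if "0 \<le> j" for j
    using e s_nz[of j] s_nz[of "j + 1"] that by (elim disjE) (simp_all add: ac_simps)
  have e_nz: "of_int j + e \<noteq> 0" if "1 \<le> j" for j
  proof -
    have "of_int j \<noteq> (0 :: complex)" "of_int (j + 1) \<noteq> (0 :: complex)"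
      using that by (simp_all only: of_int_eq_0_iff)
    thus ?thesis using e by auto
  qed
  have l: "l \<noteq> 0" using m_nonzero[of 0 1] unfolding m_eq by auto
  have s: "s \<noteq> 0" using s_nz[of 0] by simp
  define w where "w = 2 * N + s + e"
  have w: "w - 2 \<noteq> 0" "w - 1 \<noteq> 0" "w \<noteq> 0" "w + 1 \<noteq> 0"
    using se_nz[of "2 * n - 2"] se_nz[of "2 * n - 1"] se_nz[of "2 * n"] se_nz[of "2 * n + 1"] n
    unfolding w_def N_def by (simp_all add: algebra_simps)
  have first: "c (j + 1) j = (2 * of_int j + 1 + e) / (4 * l * s * (2 * of_int j + 1 + s + e))" if "0 \<le> j" for j
  proof -
    have "of_int (2 * j + 1) + s + e \<noteq> 0" using se_nz[of "2 * j + 1"] that by simp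
    hence 1: "2 * of_int j + 1 + s + e \<noteq> 0" by simp
    have "of_int (2 * j + 2) + e \<noteq> 0" using e_nz[of "2 * j + 2"] that by simp
    hence 2: "2 * of_int j + 2 + e \<noteq> 0" by simp
    have "c (j + 1) j = (of_int j + 1) * (of_int j + 1 / 2 + e)
        / (l * s * (2 * of_int j + 2 + e) * (2 * of_int j + 1 + s + e))"
      unfolding c_below_diag[OF that] d_eq m_eq by (simp add: algebra_simps)
    also have "\<dots> = (2 * of_int j + 1 + e) / (4 * l * s * (2 * of_int j + 1 + s + e))"
    proof -
      have "4 * ((of_int j + 1) * (of_int j + 1 / 2 + e)) = (2 * of_int j + 1 + e) * (2 * of_int j + 2 + e)"
        using e by (elim disjE) (simp_all add: algebra_simps)
      thus ?thesis by (rule cancel_quarter[OF _ 2])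
    qed
    finally show ?thesis .
  qed
  have F: "c n (n - 1) = (2 * N - 1 + e) / (4 * l * s * (w - 1))"
    using first[of "n - 1"] n unfolding w_def N_def by (simp add: algebra_simps)
  have F': "c (n + 1) n = (2 * N + 1 + e) / (4 * l * s * (w + 1))"
    using first[of n] n unfolding w_def N_def by (simp add: algebra_simps)
  have "(2 * N - 1 + e) * (w + 1) - (2 * N + 1 + e) * (w - 1) = - 2 * s"
    unfolding w_def by (simp add: algebra_simps)
  hence al: "diag_coeff (\<lambda>k. r0) n = - (1 / (2 * l * (w - 1) * (w + 1))) - r0"
    unfolding diag_coeff_def F F' by (subst first_coeff_difference[OF _ l s w(2,4)]) auto
  define A where "A = (\<lambda>k. (of_int k + N + e) * (of_int k + N - 1 + s + e)
      / (4 * l * (w - 2) * (w - 1) * ((of_int k - N) * (of_int k - N + 1 - s))))"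
  define A' where "A' = (\<lambda>k. (of_int k + N + 1 + e) * (of_int k + N + s + e)
      / (4 * l * w * (w + 1) * ((of_int k - N - 1) * (of_int k - N - s))))"
  show ?thesis
  proof (rule three_termI[where A = A and A' = A' and b = "1 / (16 * l ^ 2 * (w - 2) * (w - 1) ^ 2 * w)"])
    show "m n (- 1) \<noteq> 0"
    proof -
      have "of_int (n + 1) \<noteq> (0 :: complex)" "of_int n + s \<noteq> 0" "of_int n + e \<noteq> 0" "of_int (n - 1) + s + e \<noteq> 0"
        using n s_nz[of n] e_nz[of n] se_nz[of "n - 1"] by (simp_all only: of_int_eq_0_iff, simp_all)
      moreover have "m n (- 1) = l * of_int (n + 1) * (of_int n + s) * (of_int n + e) * (of_int (n - 1) + s + e)"
        unfolding m_eq by (simp add: algebra_simps)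
      ultimately show ?thesis using l by simp
    qed
  next
    have "A (n - 1) = (2 * N - 1 + e) * (w - 2) / (4 * l * (w - 2) * (w - 1) * s)"
      unfolding A_def w_def N_def by (simp add: algebra_simps)
    thus "A (n - 1) = c n (n - 1)" unfolding F by (simp only: cancel_factor[OF w(1)])
  next
    have "A' n = (2 * N + 1 + e) * w / (4 * l * w * (w + 1) * s)"
      unfolding A'_def w_def N_def by (simp add: algebra_simps)
    thus "A' n = c (n + 1) n" unfolding F' by (simp only: cancel_factor[OF w(3)])
  next
    fix k assume k: "0 \<le> k" "k < n - 1"
    define x where "x = (of_int k :: complex)"
    have "of_int (k - n) \<noteq> (0 :: complex)" "of_int (k - n + 1) \<noteq> (0 :: complex)"
      using k by (simp_all only: of_int_eq_0_iff)
    hence nz1: "x - N \<noteq> 0" "x - N + 1 \<noteq> 0" unfolding x_def N_def by simp_all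
    have nz2: "x - N + 1 - s \<noteq> 0" "x - N + 2 - s \<noteq> 0"
      using s_nz[of "n - k - 1"] s_nz[of "n - k - 2"] k unfolding N_def x_def by (auto simp: algebra_simps)
    have A1: "A (k + 1) = (x + N + 1 + e) * (x + N + s + e)
      / (4 * l * (w - 2) * (w - 1) * ((x - N + 1) * (x - N + 2 - s)))"
      and A0: "A k = (x + N + e) * (x + N - 1 + s + e)
      / (4 * l * (w - 2) * (w - 1) * ((x - N) * (x - N + 1 - s)))"
      and m: "m (n - 1) k = l * (x - N + 1) * (x - N + 2 - s) * (x + N + e) * (x + N - 1 + s + e)"
        "m n k = l * (x - N) * (x - N + 1 - s) * (x + N + 1 + e) * (x + N + s + e)"
      unfolding A_def m_eq N_def x_def by (simp_all add: algebra_simps)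
    show "A (k + 1) * m (n - 1) k = A k * m n k"
      unfolding A1 A0 m by (rule swap_cancel4[OF nz1(2) nz2(2) nz1(1) nz2(1)])
  next
    fix k assume k: "0 \<le> k" "k < n"
    define x where "x = (of_int k :: complex)"
    have "of_int (k - n) \<noteq> (0 :: complex)" "of_int (k - n - 1) \<noteq> (0 :: complex)"
      using k by (simp_all only: of_int_eq_0_iff)
    hence nz1: "x - N \<noteq> 0" "x - N - 1 \<noteq> 0" unfolding x_def N_def by simp_all
    have nz2: "x - N + 1 - s \<noteq> 0" "x - N - s \<noteq> 0"
      using s_nz[of "n - k - 1"] s_nz[of "n - k"] k unfolding N_def x_def by (auto simp: algebra_simps)
    have A1: "A' (k + 1) = (x + N + 2 + e) * (x + N + 1 + s + e)
      / (4 * l * w * (w + 1) * ((x - N) * (x - N + 1 - s)))"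
      and A0: "A' k = (x + N + 1 + e) * (x + N + s + e)
      / (4 * l * w * (w + 1) * ((x - N - 1) * (x - N - s)))"
      and m: "m (n + 1) k = l * (x - N - 1) * (x - N - s) * (x + N + 2 + e) * (x + N + 1 + s + e)"
        "m n k = l * (x - N) * (x - N + 1 - s) * (x + N + 1 + e) * (x + N + s + e)"
      unfolding A'_def m_eq N_def x_def by (simp_all add: algebra_simps)
    show "A' (k + 1) * m n k = A' k * m (n + 1) k"
      unfolding A1 A0 m by (rule swap_cancel4[OF nz1(1) nz2(1) nz1(2) nz2(2)])
  next
    fix k assume k: "0 \<le> k" "k \<le> n - 1"
    define x where "x = (of_int k :: complex)"
    define a g h i where "a = x - 1 - N" and "g = x - N - s" and "h = x + N + e" and "i = x + N - 1 + s + e"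
    have "of_int (k - 1 - n) \<noteq> (0 :: complex)" "of_int (k - n) \<noteq> (0 :: complex)"
      using k by (simp_all only: of_int_eq_0_iff)
    hence a: "a \<noteq> 0" "a + 1 \<noteq> 0" unfolding x_def N_def a_def by simp_all
    have g: "g \<noteq> 0" "g + 1 \<noteq> 0"
      using s_nz[of "n - k"] s_nz[of "n - k - 1"] k unfolding N_def x_def g_def by (auto simp: algebra_simps)
    have h: "h \<noteq> 0" using e_nz[of "k + n"] k n unfolding h_def x_def N_def by simp
    have i: "i \<noteq> 0" using se_nz[of "k + n - 1"] k n unfolding i_def x_def N_def by simp
    have d: "d (k - 1) = x * (x - 1 / 2 + e)" unfolding d_eq x_def by (simp add: algebra_simps)
    have m: "m n (k - 1) = l * a * g * h * i"
      unfolding m_eq a_def g_def h_def i_def x_def N_def by (simp add: algebra_simps)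
    have A': "A' k = (h + 1) * (i + 1) / (4 * l * w * (w + 1) * (a * g))"
      unfolding A'_def a_def g_def h_def i_def x_def by (simp add: algebra_simps)
    have A: "A k = h * i / (4 * l * (w - 2) * (w - 1) * ((a + 1) * (g + 1)))"
      unfolding A_def a_def g_def h_def i_def x_def by (simp add: algebra_simps)
    have "d (k - 1) / m n (k - 1) - r0 - diag_coeff (\<lambda>k. r0) n - A' k
      = x * (x - 1 / 2 + e) / (l * a * g * h * i) + 1 / (2 * l * (w - 1) * (w + 1))
        - (h + 1) * (i + 1) / (4 * l * w * (w + 1) * (a * g))"
      unfolding d m A' al by simp
    also have "\<dots> = (a + 1) * (g + 1) / (4 * l * (w - 1) * w * (h * i))"
    proof (rule quartic_identity_divided[OF _ l w(2-4) a(1) g(1) h i])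
      have hi: "h = g + w" "i = a + w" unfolding a_def g_def h_def i_def w_def by simp_all
      have agw: "a + g + w = 2 * x - 1 + e" unfolding a_def g_def w_def by simp
      have y: "4 * (x * (x - 1 / 2 + e)) = (a + g + w) * (a + g + w + 1)"
        unfolding agw using e by (elim disjE) (simp_all add: algebra_simps)
      show "4 * (x * (x - 1 / 2 + e)) * ((w - 1) * w * (w + 1)) + 2 * w * (a * g * h * i)
        - (w - 1) * ((h + 1) * (i + 1) * (h * i)) = (w + 1) * ((a + 1) * (g + 1) * (a * g))"
        unfolding y unfolding hi by (simp only: mult.assoc quartic_identity[unfolded mult.assoc])
    qed
    finally have B: "d (k - 1) / m n (k - 1) - r0 - diag_coeff (\<lambda>k. r0) n - A' k = \<dots>" .
    show "A k * (d (k - 1) / m n (k - 1) - r0 - diag_coeff (\<lambda>k. r0) n - A' k)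
      = 1 / (16 * l ^ 2 * (w - 2) * (w - 1) ^ 2 * w)"
      unfolding B A by (rule cancel_all) (use a g h i in simp_all)
  qed (use n in auto)
qed

section \<open>Recurrence coefficients as values of rational functions\<close>

text \<open>
  As \<open>N(n, k) \<noteq> 0\<close> for \<open>n > k \<ge> 0\<close>, \<open>f\<^sub>1(j) = D(j) / N(j + 1, j) = c(j + 1, j)\<close> and
  \<open>f\<^sub>2(j) = D(j) D(j + 1) / (N(j + 2, j) N(j + 2, j + 1)) = c(j + 2, j)\<close>. At \<open>n = 0\<close> the conventions for
  \<open>\<alpha>\<^sub>0\<close> and \<open>\<beta>\<^sub>0\<close> amount to \<open>c(0, -1) = 0\<close> and \<open>c(1, -1) = 0\<close>.
\<close>

lemma
  assumes D: "D \<noteq> 0" and f: "f = Fract N [:D:]"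
    and arr: "hypergeometric_array c (\<lambda>k. poly D (of_int k)) (\<lambda>n k. eval_bivar N (of_int n) (of_int k))"
  shows alpha_coeff_eq: "alpha_coeff R f n = hypergeometric_array.diag_coeff c (\<lambda>k. poly R (of_int k)) (int n)"
    and beta_coeff_eq: "beta_coeff R f n = hypergeometric_array.off_coeff c (\<lambda>k. poly R (of_int k)) (int n + 1)"
proof -
  interpret hypergeometric_array c "\<lambda>k. poly D (of_int k)" "\<lambda>n k. eval_bivar N (of_int n) (of_int k)"
    by (rule arr)
  let ?r = "\<lambda>k. poly R (of_int k)"
  have f1: "has_value (f1 f) (of_nat j) (c (int j + 1) (int j))" for j
  proof -
    have "eval_bivar N (of_nat j + 1) (of_nat j) \<noteq> 0"
      using m_nonzero[of "int j" "int j + 1"] by simp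
    from has_value_inverse_diag_shift[OF D this] c_below_diag[of "int j"]
    show ?thesis unfolding f1_def f by simp
  qed
  have f1_shift: "has_value (ratfun_shift 1 (f1 f)) (of_nat j) (c (int j + 2) (int j + 1))" for j
    by (rule has_value_ratfun_shift) (use f1[of "Suc j"] in \<open>simp add: add.commute\<close>)
  have f2: "has_value (f2 f) (of_nat j) (c (int j + 2) (int j))" for j
  proof -
    have nz: "eval_bivar N (of_nat j + 2) (of_nat j) \<noteq> 0"
      using m_nonzero[of "int j" "int j + 2"] by simp
    from has_value_mult[OF has_value_inverse_diag_shift[OF D this] f1_shift]
    show ?thesis unfolding f2_def f[symmetric] using c_step[of "int j + 2" "int j"] nz by simp
  qed
  have al: "has_value (alpha R f) (of_nat (Suc j)) (diag_coeff ?r (int (Suc j)))" for j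
    unfolding alpha_def diag_coeff_def
    using f1[of j] has_value_to_fract[of R "of_nat (Suc j)"] f1[of "Suc j"]
    by (intro has_value_diff has_value_ratfun_shift) (simp_all add: add.commute)
  show "alpha_coeff R f n = diag_coeff ?r (int n)"
  proof (cases n)
    case 0 thus ?thesis using ratfun_eval_eq[OF f1[of 0]]
      by (simp add: alpha_coeff_def diag_coeff_def c_outside)
  next
    case (Suc j) thus ?thesis using ratfun_eval_eq[OF al[of j]] by (simp add: alpha_coeff_def)
  qed
  show "beta_coeff R f n = off_coeff ?r (int n + 1)"
  proof (cases n)
    case 0 thus ?thesis using ratfun_eval_eq[OF f1[of 0]] ratfun_eval_eq[OF f2[of 0]] ratfun_eval_eq[OF al[of 0]]
      by (simp add: beta_coeff_def off_coeff_def c_outside algebra_simps)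
  next
    case (Suc j)
    have "has_value (ratfun_shift (- 1) (f2 f)) (of_nat (Suc j)) (c (int j + 2) (int j))"
      by (rule has_value_ratfun_shift) (use f2[of j] in simp)
    moreover have "has_value (ratfun_shift 1 (alpha R f)) (of_nat (Suc j)) (diag_coeff ?r (int j + 2))"
      by (rule has_value_ratfun_shift) (use al[of "Suc j"] in \<open>simp add: add.commute\<close>)
    ultimately have "has_value (beta R f) (of_nat (Suc j))
      (c (int j + 2) (int j) - c (int (Suc j) + 2) (int (Suc j))
        - c (int (Suc j) + 1) (int (Suc j)) * (diag_coeff ?r (int j + 2) + poly R (of_nat (Suc j))))"
      unfolding beta_def by (intro has_value_diff has_value_mult has_value_add f1 f2 has_value_to_fract)
    from ratfun_eval_eq[OF this] Suc show ?thesis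
      by (simp add: beta_coeff_def off_coeff_def algebra_simps)
  qed
qed

section \<open>Numerators of a determined family do not vanish\<close>

text \<open>
  As \<open>m k = 0\<close>, a solution may vanish above \<open>k\<close> and be \<open>1\<close> at \<open>k\<close>; from there it is continued downwards by
  division. It may vanish again below \<open>0\<close> because \<open>d (-1) = 0\<close>.
\<close>

lemma truncated_solution:
  fixes d m :: "int \<Rightarrow> complex"
  assumes "d (- 1) = 0" "0 \<le> k" "m k = 0" and nz: "\<And>j. 0 \<le> j \<Longrightarrow> j < k \<Longrightarrow> m j \<noteq> 0"
  obtains \<delta> where "\<delta> k = 1" "\<And>j. \<not> (0 \<le> j \<and> j \<le> k) \<Longrightarrow> \<delta> j = 0" "\<And>j. d j * \<delta> (j + 1) = m j * \<delta> j"
proof -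
  define \<delta> where "\<delta> = (\<lambda>j. if 0 \<le> j \<and> j \<le> k then \<Prod>i\<in>{j..<k}. d i / m i else 0)"
  have "\<delta> k = 1" using assms(2) by (simp add: \<delta>_def)
  moreover have "\<delta> j = 0" if "\<not> (0 \<le> j \<and> j \<le> k)" for j using that by (auto simp: \<delta>_def)
  moreover have "d j * \<delta> (j + 1) = m j * \<delta> j" for j
  proof -
    consider "0 \<le> j" "j < k" | "j = -1" | "j = k" | "j < -1 \<or> k < j" by linarith
    thus ?thesis
    proof cases
      case 1
      hence "{j..<k} = insert j {j + 1..<k}" by auto
      hence "\<delta> j = d j / m j * \<delta> (j + 1)" using 1 by (simp add: \<delta>_def)
      thus ?thesis using nz[OF 1] by simp
    qed (use assms in \<open>auto simp: \<delta>_def\<close>)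
  qed
  ultimately show thesis by (rule that)
qed

text \<open>
  A pair \<open>N\<close>, \<open>D\<close> that represents \<open>f\<close> is a multiple of the coprime pair, so the relation
  carries over to it.
\<close>

lemma HG_family_relation:
  assumes "HG_family P R f" and f: "f = Fract N [:D:]" and D: "D \<noteq> 0"
  obtains c where "newton_coeffs R P c"
    "\<And>n k :: int. poly D (of_int k) * c n (k + 1) = eval_bivar N (of_int n) (of_int k) * c n k"
proof -
  obtain N' :: "complex poly poly" and D' c where c: "D' \<noteq> 0" "coprime N' [:D':]" "f = Fract N' [:D':]" "newton_coeffs R P c"
    "\<And>n k :: int. poly D' (of_int k) * c n (k + 1) = eval_bivar N' (of_int n) (of_int k) * c n k"
    using assms(1) unfolding HG_family_def by blast
  obtain h where h: "N = N' * h" "[:D:] = [:D':] * h"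
    using fract_eq_coprimeE[of N "[:D:]" N' "[:D':]"] c f D by auto
  have "poly D y = poly D' y * eval_bivar h x y" for x y
    using arg_cong[OF h(2), of "\<lambda>p. eval_bivar p x y"] unfolding eval_bivar_simps .
  hence "poly D (of_int k) * c n (k + 1) = eval_bivar N (of_int n) (of_int k) * c n k" for n k :: int
    unfolding h(1) eval_bivar_simps using c(5)[of k n] by (metis mult.assoc mult.commute)
  thus thesis using that c(4) by blast
qed

text \<open>
  If \<open>f\<close> were zero, then the relation at \<open>n = 0\<close>, \<open>k = -1\<close> would force \<open>c(0, 0) = 0\<close>.
\<close>

lemma HG_family_nonzero:
  assumes "HG_family P R f" shows "f \<noteq> 0"
proof
  assume "f = 0"
  hence "f = Fract 0 [:1:]" by (simp add: Zero_fract_def one_pCons)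
  then obtain c where c: "newton_coeffs R P c"
    "\<And>n k :: int. poly 1 (of_int k) * c n (k + 1) = eval_bivar 0 (of_int n) (of_int k) * c n k"
    using HG_family_relation[OF assms, of 0 1] by auto
  have "c 0 0 = 1" using poly_family_iff_diag[OF c(1)] assms unfolding HG_family_def by blast
  thus False using c(2)[of "-1" 0] by simp
qed

text \<open>
  If some \<open>N(n, k)\<close> vanishes, take the smallest such \<open>k \<ge> 0\<close> and add to the row \<open>n\<close> of coefficients the
  solution of the relation that is supported on \<open>{0..k}\<close>. As \<open>k < n\<close>, the new polynomials are still
  monic of the right degrees, and they form a different family for the same pair.
\<close>

lemma numerator_nonzero_if_determined:
  assumes family: "HG_family P R f"
    and determined: "\<And>P'. HG_family P' R f \<Longrightarrow> P' = P"
    and f: "f = Fract N [:D:]" and D: "D \<noteq> 0" "coprime N [:D:]" "poly D (- 1) = 0"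
    and c: "newton_coeffs R P c"
      "\<And>n k :: int. poly D (of_int k) * c n (k + 1) = eval_bivar N (of_int n) (of_int k) * c n k"
    and "0 \<le> k" "k < (n :: int)"
  shows "eval_bivar N (of_int n) (of_int k) \<noteq> 0"
proof
  assume "eval_bivar N (of_int n) (of_int k) = 0"
  hence ex: "eval_bivar N (of_int n) (of_int (int (nat k))) = 0" using assms(9) by simp
  define k0 where "k0 = (LEAST j. eval_bivar N (of_int n) (of_int (int j)) = 0)"
  have k0: "eval_bivar N (of_int n) (of_int (int k0)) = 0" "k0 \<le> nat k"
    unfolding k0_def by (rule LeastI, rule ex) (rule Least_le, rule ex)
  have below: "eval_bivar N (of_int n) (of_int j) \<noteq> 0" if "0 \<le> j" "j < int k0" for j
    using not_less_Least[of "nat j" "\<lambda>j. eval_bivar N (of_int n) (of_int (int j)) = 0"] that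
    unfolding k0_def[symmetric] by simp
  obtain \<delta> where \<delta>: "\<delta> (int k0) = 1" "\<And>j. \<not> (0 \<le> j \<and> j \<le> int k0) \<Longrightarrow> \<delta> j = 0"
    "\<And>j. poly D (of_int j) * \<delta> (j + 1) = eval_bivar N (of_int n) (of_int j) * \<delta> j"
    using truncated_solution[of "\<lambda>j. poly D (of_int j)" "int k0" "\<lambda>j. eval_bivar N (of_int n) (of_int j)"]
      D(3) k0(1) below by auto
  define c' where "c' = (\<lambda>m j. c m j + (if m = n then \<delta> j else 0))"
  define P' where "P' = (\<lambda>m. \<Sum>j\<le>m. smult (c' (int m) (int j)) (newton_basis R j))"
  have k0n: "int k0 < n" using k0(2) assms(9,10) by linarith
  have c0: "\<And>m j. \<not> (m \<ge> j \<and> j \<ge> 0) \<Longrightarrow> c m j = 0"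
    and P: "\<And>m. P m = (\<Sum>j\<le>m. smult (c (int m) (int j)) (newton_basis R j))"
    using c(1) unfolding newton_coeffs_def by blast+
  have "c' m j = 0" if "\<not> (m \<ge> j \<and> j \<ge> 0)" for m j
    using c0[OF that] \<delta>(2)[of j] that k0n unfolding c'_def by auto
  hence nc: "newton_coeffs R P' c'" unfolding newton_coeffs_def P'_def by blast
  have "\<forall>m\<ge>0. c m m = 1" using poly_family_iff_diag[OF c(1)] family unfolding HG_family_def by blast
  hence "\<forall>m\<ge>0. c' m m = 1" unfolding c'_def using \<delta>(2)[of n] k0n by auto
  hence "poly_family P'" using poly_family_iff_diag[OF nc] by blast
  moreover have "poly D (of_int j) * c' m (j + 1) = eval_bivar N (of_int m) (of_int j) * c' m j" for m j
    using c(2)[of j m] \<delta>(3)[of j] unfolding c'_def by (auto simp: ring_distribs)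
  ultimately have "HG_family P' R f" unfolding HG_family_def using D(1,2) f nc by blast
  hence "P' = P" by (rule determined)
  have "int (nat n) = n" using k0n by simp
  hence "(\<Sum>j\<le>nat n. smult (c' n (int j) - c n (int j)) (newton_basis R j)) = P' (nat n) - P (nat n)"
    unfolding P'_def P by (simp only: smult_diff_left sum_subtractf)
  hence "(\<Sum>j\<le>nat n. smult (c' n (int j) - c n (int j)) (newton_basis R j)) = 0"
    using \<open>P' = P\<close> by simp
  from newton_sum_eq_0[OF this, of k0] k0n have "c' n (int k0) = c n (int k0)" by simp
  thus False unfolding c'_def using \<delta>(1) by simp
qed

section \<open>The recurrence\<close>

text \<open>
  Everything that the cases have in common. The coefficient identity is required for \<open>n \<ge> 2\<close> only:
  for smaller \<open>n\<close> the values \<open>k \<ge> n - 1\<close>, which determine the coefficients of the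
  recurrence, are all there are.
\<close>

lemma recurrence_if_three_term:
  assumes family: "HG_family P R f"
    and determined: "\<And>P'. HG_family P' R f \<Longrightarrow> P' = P"
    and f: "f = Fract N [:D:]" and D: "D \<noteq> 0" "coprime N [:D:]" "poly D (- 1) = 0"
    and three_term: "\<And>c n. hypergeometric_array c (\<lambda>k. poly D (of_int k)) (\<lambda>n k. eval_bivar N (of_int n) (of_int k)) \<Longrightarrow>
      2 \<le> n \<Longrightarrow> hypergeometric_array.three_term c (\<lambda>k. poly R (of_int k)) n"
  shows "[:0, 1:] * P n = P (n + 1) + smult (alpha_coeff R f n) (P n)
      + (if n = 0 then 0 else smult (beta_coeff R f (n - 1)) (P (n - 1)))"
proof -
  obtain c where c: "newton_coeffs R P c"
    "\<And>n k :: int. poly D (of_int k) * c n (k + 1) = eval_bivar N (of_int n) (of_int k) * c n k"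
    using HG_family_relation[OF family f D(1)] by blast
  interpret hypergeometric_array c "\<lambda>k. poly D (of_int k)" "\<lambda>n k. eval_bivar N (of_int n) (of_int k)"
  proof
    show "c n n = 1" if "0 \<le> n" for n
      using poly_family_iff_diag[OF c(1)] family that unfolding HG_family_def by blast
    show "c n k = 0" if "\<not> (0 \<le> k \<and> k \<le> n)" for n k
      using c(1) that unfolding newton_coeffs_def by blast
    show "eval_bivar N (of_int n) (of_int k) \<noteq> 0" if "0 \<le> k" "k < n" for n k
      by (rule numerator_nonzero_if_determined[OF family determined f D c that])
  qed (rule c(2))
  let ?r = "\<lambda>k. poly R (of_int k)"
  have tt: "three_term ?r m" if "1 \<le> m" for m
    using that three_term[OF hypergeometric_array_axioms, of m] three_term_1 by (cases "m = 1") auto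
  hence id: "c (int n) (k - 1) - poly R (of_int k) * c (int n) k
      = c (int n + 1) k + diag_coeff ?r (int n) * c (int n) k + off_coeff ?r (int n) * c (int n - 1) k"
    if "0 \<le> k" "k \<le> int n + 1" for k
    using that tt[of "int n"]
    by (intro three_term_everywhere) (cases "n = 0"; simp)+
  have "off_coeff ?r (int n) = beta_coeff R f (n - 1)" if "n \<noteq> 0"
    using beta_coeff_eq[OF D(1) f hypergeometric_array_axioms, of R "n - 1"] that by simp
  thus ?thesis
    using recurrence_of_coefficients[OF c(1) id]
    unfolding alpha_coeff_eq[OF D(1) f hypergeometric_array_axioms] by (cases "n = 0") simp_all
qed

lemma degree_le_1_eq: "degree p \<le> 1 \<Longrightarrow> p = [:coeff p 0, coeff p 1:]"
  by (intro poly_eqI) (auto simp: coeff_pCons coeff_eq_0 split: nat.split)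

lemma degree_le_2_eq: "degree p \<le> 2 \<Longrightarrow> p = [:coeff p 0, coeff p 1, coeff p 2:]"
  by (intro poly_eqI) (auto simp: coeff_pCons coeff_eq_0 numeral_2_eq_2 split: nat.split)

lemma coprime_case_a:
  assumes "degree q \<le> 1" "q \<noteq> 0" "D \<noteq> 0"
  shows "coprime ((bivar_s - bivar_u) * compose_bivar q (bivar_s + bivar_u)) [:D:]"
proof -
  obtain q0 q1 where q: "q = [:q0, q1:]" using degree_le_1_eq[OF assms(1)] by blast
  have su: "bivar_s - bivar_u = [:[:0, 1:], -1:]" by (simp add: bivar_s_def bivar_u_def)
  have comp: "compose_bivar q (bivar_s + bivar_u) = [:[:q0, q1:], [:q1:]:]"
    unfolding q compose_bivar_pCons by (simp add: bivar_s_def bivar_u_def bivar_const_def)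
  show ?thesis
  proof (rule coprime_const_if_lead_coeff_const)
    show "lead_coeff ((bivar_s - bivar_u) * compose_bivar q (bivar_s + bivar_u))
      = [:- (if q1 = 0 then q0 else q1):]"
      unfolding lead_coeff_mult su comp by simp
    show "- (if q1 = 0 then q0 else q1) \<noteq> 0" using assms(2) q by auto
  qed (rule assms(3))
qed

lemma coprime_four_factors:
  assumes "l \<noteq> 0" "D \<noteq> 0"
  shows "coprime (bivar_const l * (bivar_s - bivar_u) * (bivar_s - bivar_u + bivar_const a)
    * (bivar_s + bivar_u + bivar_const b) * (bivar_s + bivar_u + bivar_const e)) [:D:]"
proof (rule coprime_const_if_lead_coeff_const)
  have "bivar_s - bivar_u = [:[:0, 1:], -1:]"
    "bivar_s - bivar_u + bivar_const a = [:[:a, 1:], -1:]"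
    "\<And>b. bivar_s + bivar_u + bivar_const b = [:[:b, 1:], 1:]"
    by (simp_all add: bivar_s_def bivar_u_def bivar_const_def)
  thus "lead_coeff (bivar_const l * (bivar_s - bivar_u) * (bivar_s - bivar_u + bivar_const a)
    * (bivar_s + bivar_u + bivar_const b) * (bivar_s + bivar_u + bivar_const e)) = [:l:]"
    by (simp only: lead_coeff_mult) (simp add: bivar_const_def)
qed (use assms in auto)

lemma recurrence_case_a:
  assumes family: "HG_family P R f"
    and determined: "\<And>P'. HG_family P' R f \<Longrightarrow> P' = P"
    and "case_a R f"
  shows "[:0, 1:] * P n = P (n + 1) + smult (alpha_coeff R f n) (P n)
      + (if n = 0 then 0 else smult (beta_coeff R f (n - 1)) (P (n - 1)))"
proof -
  define N where "N q = (bivar_s - bivar_u) * compose_bivar q (bivar_s + bivar_u)" for q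
  define D where "D q v = [:0, 1:] * q * (pcompose R [:1, 1:] - [:poly R 0:]) + [:1, 1:] * v" for q v
  obtain q v where qv: "degree R \<le> 2" "degree q \<le> 1" "degree v \<le> 1" "D q v \<noteq> 0" "f = Fract (N q) [:D q v:]"
    using assms(3) unfolding case_a_def N_def D_def Let_def by blast
  obtain q0 q1 v0 v1 r0 r1 r2 where eqs: "q = [:q0, q1:]" "v = [:v0, v1:]" "R = [:r0, r1, r2:]"
    using degree_le_1_eq[OF qv(2)] degree_le_1_eq[OF qv(3)] degree_le_2_eq[OF qv(1)] by blast
  have "q \<noteq> 0" using HG_family_nonzero[OF family] qv(5) by (auto simp: N_def Zero_fract_def eq_fract)
  hence cop: "coprime (N q) [:D q v:]" unfolding N_def using qv by (intro coprime_case_a)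
  have D1: "poly (D q v) (-1) = 0" by (simp add: D_def poly_pcompose)
  have r: "(\<lambda>k. poly R (of_int k)) = (\<lambda>k :: int. r0 + r1 * of_int k + r2 * of_int k ^ 2)"
    by (simp add: eqs fun_eq_iff algebra_simps power2_eq_square)
  have N_eq: "eval_bivar (N q) x y = (y - x) * (q0 + q1 * (y + x))" for x y
    by (simp add: N_def eqs algebra_simps)
  have D_eq: "poly (D q v) y = y * (q0 + q1 * y) * (r0 + r1 * (y + 1) + r2 * (y + 1) ^ 2 - (r0 + r1 * 0 + r2 * 0 ^ 2))
    + (y + 1) * (v0 + v1 * y)" for y
    by (simp add: D_def eqs poly_pcompose algebra_simps power2_eq_square)
  show ?thesis
  proof (rule recurrence_if_three_term[OF family determined qv(5,4) cop D1])
    fix c n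
    assume arr: "hypergeometric_array c (\<lambda>k. poly (D q v) (of_int k)) (\<lambda>n k. eval_bivar (N q) (of_int n) (of_int k))"
      and n: "(2 :: int) \<le> n"
    show "hypergeometric_array.three_term c (\<lambda>k. poly R (of_int k)) n"
      unfolding r by (rule hypergeometric_array.three_term_quadratic[OF arr N_eq D_eq n])
  qed
qed

text \<open>
  The value \<open>e = 0\<close> gives case (b) and \<open>e = 1\<close> gives case (c), with \<open>s\<close> and \<open>l\<close> for the parameters \<open>c\<close>
  and \<open>\<lambda>\<close>.
\<close>

lemma recurrence_case_bc:
  fixes s l e :: complex
  assumes family: "HG_family P R f"
    and determined: "\<And>P'. HG_family P' R f \<Longrightarrow> P' = P"
    and R: "degree R = 0" and e: "e = 0 \<or> e = 1"
    and f: "f = Fract (bivar_const l * (bivar_s - bivar_u) * (bivar_s - bivar_u + bivar_const (1 - s))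
      * (bivar_s + bivar_u + bivar_const (1 + e)) * (bivar_s + bivar_u + bivar_const (s + e)))
      [:[:1, 1:] * [:1 / 2 + e, 1:]:]" (is "f = Fract ?N [:?D:]")
  shows "[:0, 1:] * P n = P (n + 1) + smult (alpha_coeff R f n) (P n)
      + (if n = 0 then 0 else smult (beta_coeff R f (n - 1)) (P (n - 1)))"
proof -
  obtain r0 where R: "R = [:r0:]" using R by (rule degree_eq_zeroE)
  have D: "?D \<noteq> 0" by (simp only: mult_eq_0_iff) simp
  have "l \<noteq> 0" using HG_family_nonzero[OF family] D unfolding f
    by (auto simp: bivar_const_def Zero_fract_def eq_fract simp del: mult_pCons_left)
  hence cop: "coprime ?N [:?D:]" using D by (rule coprime_four_factors)
  have D1: "poly ?D (-1) = 0" by simp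
  have r: "(\<lambda>k. poly R (of_int k)) = (\<lambda>k :: int. r0)" by (simp add: R)
  have N_eq: "eval_bivar ?N x y = l * (y - x) * (y - x + 1 - s) * (y + x + 1 + e) * (y + x + s + e)" for x y
    by (simp add: ac_simps)
  have D_eq: "poly ?D y = (y + 1) * (y + 1 / 2 + e)" for y
    by (simp only: poly_mult) (simp add: add.commute)
  show ?thesis
  proof (rule recurrence_if_three_term[OF family determined f D cop D1])
    fix c n
    assume arr: "hypergeometric_array c (\<lambda>k. poly ?D (of_int k)) (\<lambda>n k. eval_bivar ?N (of_int n) (of_int k))"
      and n: "(2 :: int) \<le> n"
    show "hypergeometric_array.three_term c (\<lambda>k. poly R (of_int k)) n"
      unfolding r by (rule hypergeometric_array.three_term_quartic[OF arr e N_eq D_eq n])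
  qed
qed

theorem proposition2:
  fixes P :: "nat \<Rightarrow> complex poly"
    and R :: "complex poly"
    and f :: "complex poly poly fract"
  assumes family: "HG_family P R f"
    and determined: "\<And>P'. HG_family P' R f \<Longrightarrow> P' = P"
    and no_poles_f1: "\<And>n :: nat. \<not> ratfun_pole (f1 f) (of_nat n)"
    and no_poles_f2: "\<And>n :: nat. \<not> ratfun_pole (f2 f) (of_nat n)"
    and cases: "case_a R f \<or> case_b R f \<or> case_c R f"
  shows "\<forall>n. [:0, 1:] * P n =
    P (n + 1) + smult (alpha_coeff R f n) (P n)
      + (if n = 0 then 0 else smult (beta_coeff R f (n - 1)) (P (n - 1)))"
  using cases
proof (elim disjE)
  assume "case_a R f"
  thus ?thesis using recurrence_case_a[OF family determined] by blast
next
  assume "case_b R f"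
  then obtain s l where R: "degree R = 0"
    and f: "f = Fract (bivar_const l * (bivar_s - bivar_u) * (bivar_s - bivar_u + bivar_const (1 - s))
      * (bivar_s + bivar_u + 1) * (bivar_s + bivar_u + bivar_const s)) ((bivar_s + bivar_const (1/2)) * (bivar_s + 1))"
    unfolding case_b_def by blast
  have "(bivar_s + bivar_const (1/2)) * (bivar_s + 1) = [:[:1, 1:] * [:1 / 2 + 0, 1:]:]" "1 = bivar_const (1 + 0)"
    by (simp_all add: bivar_s_def bivar_const_def one_pCons)
  with f show ?thesis
    using recurrence_case_bc[OF family determined R, of 0 l s] by simp
next
  assume "case_c R f"
  then obtain s l where R: "degree R = 0"
    and f: "f = Fract (bivar_const l * (bivar_s - bivar_u) * (bivar_s - bivar_u + bivar_const (1 - s))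
      * (bivar_s + bivar_u + 2) * (bivar_s + bivar_u + bivar_const (s + 1))) ((bivar_s + 1) * (bivar_s + bivar_const (3/2)))"
    unfolding case_c_def by blast
  have "(bivar_s + 1) * (bivar_s + bivar_const (3/2)) = [:[:1, 1:] * [:1 / 2 + 1, 1:]:]" "2 = bivar_const (1 + 1)"
    by (simp_all add: bivar_s_def bivar_const_def one_pCons numeral_poly)
  with f show ?thesis
    using recurrence_case_bc[OF family determined R, of 1 l s] by simp
qed

end
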